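(* Let $K,P:\mathbb{N}_0\to\mathbb{N}_0$ with $K_n<P_n$ for all $n=1,2,\ldots$, let $\alpha:\mathbb{N}_0\to[0,1]$, and write $\theta_n=(K_n,P_n)$. Suppose that for some $c>0$ $$\alpha_n\,(1-q(\theta_n))\sim c\,\frac{\log n}{n}\qquad (n\to\infty).$$ Then $$\lim_{n\to\infty}P_n(\theta_n,\alpha_n)=\begin{cases}0 & \text{if } 0<c<1,\\ 1 & \text{if } c>1.\end{cases}$$
   Context: $\mathbb{N}_0=\{1,2,\ldots\}$ denotes the positive integers, and $a_n\sim b_n$ means $a_n/b_n\to1$ as $n\to\infty$. For positive integers $K<P$ write $\theta=(K,P)$ and set $$q(\theta)=0\ \text{ if } P<2K,\qquad q(\theta)=\binom{P-K}{K}\Big/\binom{P}{K}\ \text{ if } 2K\le P.$$ Random graph model: given a number $n$ of nodes, $\theta=(K,P)$ and $\alpha\in[0,1]$, let $K_1(\theta),\ldots,K_n(\theta)$ be i.i.d. random sets, each uniformly distributed over the collection of all $K$-element subsets of $\{1,\ldots,P\}$. Let $B_{ij}(\alpha)$, $1\le i<j\le n$, be i.i.d. $\{0,1\}$-valued random variables with $\mathbb{P}[B_{ij}(\alpha)=1]=\alpha$, independent of the family $K_1(\theta),\ldots,K_n(\theta)$; put $B_{ji}(\alpha)=B_{ij}(\alpha)$. The random graph $\mathbb{K}\cap\mathbb{G}(n;\theta,\alpha)$ is the undirected graph on the vertex set $\{1,\ldots,n\}$ in which distinct nodes $i,j$ are adjacent if and only if $K_i(\theta)\cap K_j(\theta)\ne\emptyset$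 and $B_{ij}(\alpha)=1$. (It is the intersection of a random key graph and an Erdős–Rényi graph.) $P_n(\theta,\alpha)$ denotes the probability that $\mathbb{K}\cap\mathbb{G}(n;\theta,\alpha)$ contains no isolated nodes. *)

theory Defs
  imports "HOL-Probability.Probability" "HOL-Probability.Product_PMF" "HOL-Library.Landau_Symbols"
begin

definition q :: "nat \<Rightarrow> nat \<Rightarrow> real" where
  "q K P = (if P < 2 * K then 0 else real ((P - K) choose K) / real (P choose K))"

definition key_ring_pmf :: "nat \<Rightarrow> nat \<Rightarrow> nat set pmf" where
  "key_ring_pmf K P = pmf_of_set {S. S \<subseteq> {1..P} \<and> card S = K}"

text \<open>
  The joint law of \<open>(K\<^sub>i)\<close>, \<open>1 \<le> i \<le> n\<close>, and \<open>(B\<^sub>i\<^sub>j)\<close>, \<open>1 \<le> i < j \<le> n\<close>; the values \<open>True\<close> and \<open>False\<close> stand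
  for 1 and 0. Outside these index sets the functions take the constant values \<open>{}\<close> and \<open>False\<close>.
\<close>
definition key_channel_pmf ::
  "nat \<Rightarrow> nat \<Rightarrow> nat \<Rightarrow> real \<Rightarrow> ((nat \<Rightarrow> nat set) \<times> (nat \<times> nat \<Rightarrow> bool)) pmf" where
  "key_channel_pmf n K P \<alpha> =
     pair_pmf (Pi_pmf {1..n} {} (\<lambda>_. key_ring_pmf K P))
              (Pi_pmf {(i, j). 1 \<le> i \<and> i < j \<and> j \<le> n} False (\<lambda>_. bernoulli_pmf \<alpha>))"

text \<open>
  A graph on the vertex set \<open>{1..n}\<close> is represented by its set of edges, each edge being an
  unordered pair. Only \<open>B (i, j)\<close> with \<open>i < j\<close> is used, which amounts to \<open>B\<^sub>j\<^sub>i = B\<^sub>i\<^sub>j\<close>.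
\<close>
definition kg_edges ::
  "nat \<Rightarrow> (nat \<Rightarrow> nat set) \<Rightarrow> (nat \<times> nat \<Rightarrow> bool) \<Rightarrow> nat set set" where
  "kg_edges n S B =
     {{i, j} | i j. 1 \<le> i \<and> i < j \<and> j \<le> n \<and> S i \<inter> S j \<noteq> {} \<and> B (i, j)}"

definition kg_graph_pmf :: "nat \<Rightarrow> nat \<Rightarrow> nat \<Rightarrow> real \<Rightarrow> nat set set pmf" where
  "kg_graph_pmf n K P \<alpha> = map_pmf (\<lambda>(S, B). kg_edges n S B) (key_channel_pmf n K P \<alpha>)"

definition isolated_node :: "nat set set \<Rightarrow> nat \<Rightarrow> bool" where
  "isolated_node E i \<longleftrightarrow> (\<forall>j. {i, j} \<notin> E)"

definition prob_no_isolated :: "nat \<Rightarrow> nat \<Rightarrow> nat \<Rightarrow> real \<Rightarrow> real" where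
  "prob_no_isolated n K P \<alpha> =
     measure_pmf.prob (kg_graph_pmf n K P \<alpha>) {E. \<forall>i\<in>{1..n}. \<not> isolated_node E i}"

end

theory Submission
  imports Defs
begin

text \<open>
  Write \<open>p = \<alpha> (1 - q)\<close> for the probability of a single edge. Conditionally on the key ring of a node \<open>i\<close>,
  its \<open>n - 1\<close> potential edges are independent and each is present with probability \<open>p\<close>, whatever the
  ring is; so \<open>i\<close> is isolated with probability \<open>(1 - p) ^ (n - 1)\<close>, and the expected number of isolated
  nodes is \<open>n (1 - p) ^ (n - 1) = n ^ (1 - c + o(1))\<close>. For \<open>c > 1\<close> this tends to 0 and the union bound
  (\<open>prob_no_isolated_ge\<close>) finishes.

  For \<open>c < 1\<close> it tends to infinity, and Chebyshev's argument (\<open>prob_none_le_second_moment\<close>) needs that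
  two nodes \<open>i, i'\<close> are isolated almost independently. Condition on both rings \<open>A, A'\<close>. Then the other
  \<open>n - 2\<close> nodes are independent again, and each is adjacent to neither with probability
  \<open>1 - 2 p + \<alpha>\<^sup>2 \<pi>\<close>, where \<open>\<pi>\<close> is the probability that a random ring meets both \<open>A\<close> and \<open>A'\<close>
  (\<open>expectation_not_adjacent_to_two_le\<close>).

  \<^item> If \<open>A\<close> and \<open>A'\<close> are disjoint, meeting \<open>A\<close> and meeting \<open>A'\<close> are negatively correlated, since rings
    have fixed size. So \<open>\<pi> \<le> (1 - q)\<^sup>2\<close>, and the probability is at most \<open>(1 - p)\<^sup>2\<close>, as for
    independent nodes.

  \<^item> If they meet, which happens with probability \<open>1 - q\<close>, the crude bound \<open>\<pi> \<le> 1 - q\<close> suffices: it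
    gives \<open>1 - 2 p + \<alpha> p\<close>. The \<open>(n - 2)\<close>-th power of this exceeds that of \<open>(1 - p)\<^sup>2\<close> by a relative
    amount of about \<open>exp (\<alpha> n p) - 1\<close>, and convexity in \<open>\<alpha>\<close> bounds this by \<open>\<alpha> exp (n p)\<close>.

  The total relative excess is thus at most about \<open>(1 - q) \<alpha> exp (n p) = p exp (n p)\<close>
  (\<open>second_moment_ratio\<close>), which is \<open>n ^ (c - 1 + o(1))\<close> and vanishes. Because \<open>1 - q\<close> and \<open>\<alpha>\<close> recombine
  to \<open>p\<close>, nothing has to be assumed about how \<open>p\<close> splits into the two factors.
\<close>

section \<open>Random key rings\<close>

lemma key_rings:
  assumes "K \<le> P"
  shows "finite {S. S \<subseteq> {1..P} \<and> card S = K}" "{S. S \<subseteq> {1..P} \<and> card S = K} \<noteq> {}"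
proof -
  show "finite {S. S \<subseteq> {1..P} \<and> card S = K}"
    by (rule finite_subset[of _ "Pow {1..P}"]) auto
  have "{1..K} \<in> {S. S \<subseteq> {1..P} \<and> card S = K}" using assms by auto
  then show "{S. S \<subseteq> {1..P} \<and> card S = K} \<noteq> {}" by blast
qed

lemma set_key_ring_pmf:
  assumes "K \<le> P"
  shows "set_pmf (key_ring_pmf K P) = {S. S \<subseteq> {1..P} \<and> card S = K}"
  unfolding key_ring_pmf_def using key_rings[OF assms] by (simp add: set_pmf_of_set)

lemma prob_key_ring_avoids:
  assumes "K \<le> P" "A \<subseteq> {1..P}"
  shows "measure_pmf.prob (key_ring_pmf K P) {S. A \<inter> S = {}} =
           real ((P - card A) choose K) / real (P choose K)"
proof -
  have "{S. S \<subseteq> {1..P} \<and> card S = K} \<inter> {S. A \<inter> S = {}} = {S. S \<subseteq> {1..P} - A \<and> card S = K}"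
    by auto
  moreover have "card ({1..P} - A) = P - card A"
    using assms(2) finite_subset[OF assms(2)] by (simp add: card_Diff_subset)
  ultimately show ?thesis
    unfolding key_ring_pmf_def using key_rings[OF assms(1)]
    by (simp add: measure_pmf_of_set n_subsets)
qed

lemma q_eq_choose: "q K P = real ((P - K) choose K) / real (P choose K)"
  unfolding q_def by (simp add: binomial_eq_0)

lemma q_nonneg: "0 \<le> q K P"
  by (simp add: q_eq_choose)

lemma q_le_1: assumes "K \<le> P" shows "q K P \<le> 1"
proof -
  have "(P - K) choose K \<le> P choose K" by (rule binomial_right_mono) simp
  then show ?thesis using assms by (simp add: q_eq_choose zero_less_binomial divide_le_eq)
qed

text \<open>After division by the square of \<open>P choose K\<close> this is the negative correlation of avoiding two disjoint
  key rings. It holds factor by factor in the falling factorials: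
  \<open>(P - K - i)\<^sup>2 - (P - 2 K - i) (P - i) = K\<^sup>2\<close>.\<close>

lemma binomial_log_concave_shift:
  "((P - 2 * K) choose K) * (P choose K) \<le> ((P - K) choose K)\<^sup>2"
proof (cases "3 * K \<le> P")
  \<comment> \<open>Below \<open>3 * K\<close> the factors of the falling factorials may be negative, but there the first
      coefficient vanishes.\<close>
  case False
  then show ?thesis by (simp add: binomial_eq_0)
next
  case True
  have ch: "real (m choose K) = (\<Prod>i<K. real m - real i) / fact K" for m
    by (simp add: binomial_gbinomial gbinomial_prod_rev lessThan_atLeast0)
  have "(\<Prod>i<K. real (P - 2 * K) - real i) * (\<Prod>i<K. real P - real i)
          = (\<Prod>i<K. (real (P - 2 * K) - real i) * (real P - real i))"
    by (simp add: prod.distrib)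
  also have "\<dots> \<le> (\<Prod>i<K. (real (P - K) - real i)\<^sup>2)"
  proof (rule prod_mono, intro conjI)
    fix i assume "i \<in> {..<K}"
    then have i: "real i < real K" "real (P - 2 * K) = real P - 2 * real K" "real (P - K) = real P - real K"
      "real P \<ge> 3 * real K"
      using True by (auto simp: of_nat_diff)
    show "0 \<le> (real (P - 2 * K) - real i) * (real P - real i)"
      using i by (intro mult_nonneg_nonneg) linarith+
    have "(real P - real K - real i)\<^sup>2 - (real P - 2 * real K - real i) * (real P - real i) = (real K)\<^sup>2"
      by (simp add: algebra_simps power2_eq_square)
    then show "(real (P - 2 * K) - real i) * (real P - real i) \<le> (real (P - K) - real i)\<^sup>2"
      unfolding i(2,3) using zero_le_power2[of "real K"] by linarith
  qed
  also have "\<dots> = (\<Prod>i<K. real (P - K) - real i)\<^sup>2"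
    by (simp add: prod_power_distrib)
  finally have "real ((P - 2 * K) choose K) * real (P choose K) \<le> (real ((P - K) choose K))\<^sup>2"
    by (simp add: ch power2_eq_square divide_right_mono)
  then show ?thesis
    by (metis of_nat_le_iff of_nat_mult of_nat_power)
qed

section \<open>No edges between a set of nodes and its complement\<close>

lemma expectation_pair_pmf:
  fixes f :: "'a \<times> 'b \<Rightarrow> real"
  assumes "finite (set_pmf A)" "finite (set_pmf B)"
  shows "measure_pmf.expectation (pair_pmf A B) f =
           measure_pmf.expectation A (\<lambda>a. measure_pmf.expectation B (\<lambda>b. f (a, b)))"
proof -
  have "measure_pmf.expectation (pair_pmf A B) f =
      (\<Sum>x\<in>set_pmf A \<times> set_pmf B. f x * pmf (pair_pmf A B) x)"
    using assms by (intro integral_measure_pmf_real) auto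
  also have "\<dots> = (\<Sum>a\<in>set_pmf A. (\<Sum>b\<in>set_pmf B. f (a, b) * pmf B b) * pmf A a)"
    by (simp add: sum.cartesian_product' pmf_pair sum_distrib_left sum_distrib_right mult_ac)
  also have "\<dots> = (\<Sum>a\<in>set_pmf A. measure_pmf.expectation B (\<lambda>b. f (a, b)) * pmf A a)"
    using assms by (intro sum.cong refl arg_cong2[where f = "(*)"] integral_measure_pmf_real[symmetric]) auto
  also have "\<dots> = measure_pmf.expectation A (\<lambda>a. measure_pmf.expectation B (\<lambda>b. f (a, b)))"
    using assms by (intro integral_measure_pmf_real[symmetric]) auto
  finally show ?thesis .
qed

lemma finite_set_Pi_pmf:
  assumes "finite A" "\<And>x. x \<in> A \<Longrightarrow> finite (set_pmf (p x))"
  shows "finite (set_pmf (Pi_pmf A d p))"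
  using assms by (auto simp: set_Pi_pmf)

text \<open>The channels between \<open>T\<close> and its complement are pairwise distinct, so for a fixed relation \<open>R\<close> their
  states are independent and the event is a product set. The two orderings of a pair are identified by
  \<open>(min i j, max i j)\<close>, which is injective on \<open>T\<close> times its complement.\<close>

lemma prob_pairs_absent:
  fixes R :: "nat \<Rightarrow> nat \<Rightarrow> bool"
  assumes T: "T \<subseteq> {1..n}" and \<alpha>: "0 \<le> \<alpha>" "\<alpha> \<le> 1"
  shows "measure_pmf.prob (Pi_pmf {(i, j). 1 \<le> i \<and> i < j \<and> j \<le> n} False (\<lambda>_. bernoulli_pmf \<alpha>))
            {B. \<forall>i\<in>T. \<forall>j\<in>{1..n} - T. R i j \<longrightarrow> \<not> B (min i j, max i j)}
         = (\<Prod>j\<in>{1..n} - T. \<Prod>i\<in>T. if R i j then 1 - \<alpha> else 1)"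
proof -
  define E where "E = {(i, j). 1 \<le> i \<and> i < j \<and> j \<le> n}"
  define U where "U = ({1..n} - T) \<times> T"
  define m where "m = (\<lambda>(j::nat, i). (min i j, max i j))"
  define D where "D = (\<lambda>e. {b. \<forall>(j, i)\<in>U. m (j, i) = e \<and> R i j \<longrightarrow> \<not> b})"
  have finE: "finite E"
    by (rule finite_subset[of _ "{1..n} \<times> {1..n}"]) (auto simp: E_def)
  have mE: "m ` U \<subseteq> E"
  proof (rule image_subsetI)
    fix u assume "u \<in> U"
    then obtain j i where u: "u = (j, i)" "j \<in> {1..n} - T" "i \<in> T" by (auto simp: U_def)
    with T have "i \<in> {1..n}" "i \<noteq> j" by auto
    with u show "m u \<in> E" by (auto simp: m_def E_def)
  qed
  have inj: "inj_on m U"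
    by (auto simp: inj_on_def m_def U_def min_def max_def split: if_splits)
  have "{B. \<forall>i\<in>T. \<forall>j\<in>{1..n} - T. R i j \<longrightarrow> \<not> B (min i j, max i j)} = Pi E D"
  proof (intro set_eqI iffI)
    fix B assume "B \<in> {B. \<forall>i\<in>T. \<forall>j\<in>{1..n} - T. R i j \<longrightarrow> \<not> B (min i j, max i j)}"
    then show "B \<in> Pi E D" by (auto simp: D_def U_def m_def)
  next
    fix B assume B: "B \<in> Pi E D"
    have "\<not> B (m (j, i))" if "i \<in> T" "j \<in> {1..n} - T" "R i j" for i j
    proof -
      have u: "(j, i) \<in> U" using that by (simp add: U_def)
      then have "m (j, i) \<in> E" using mE by blast
      with B have "B (m (j, i)) \<in> D (m (j, i))" by blast
      then show ?thesis using u that(3) by (auto simp: D_def)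
    qed
    then show "B \<in> {B. \<forall>i\<in>T. \<forall>j\<in>{1..n} - T. R i j \<longrightarrow> \<not> B (min i j, max i j)}"
      by (simp add: m_def)
  qed
  then have "measure_pmf.prob (Pi_pmf E False (\<lambda>_. bernoulli_pmf \<alpha>))
            {B. \<forall>i\<in>T. \<forall>j\<in>{1..n} - T. R i j \<longrightarrow> \<not> B (min i j, max i j)}
     = (\<Prod>e\<in>E. measure_pmf.prob (bernoulli_pmf \<alpha>) (D e))"
    using finE by (simp add: measure_Pi_pmf_Pi)
  also have "\<dots> = (\<Prod>e\<in>m ` U. measure_pmf.prob (bernoulli_pmf \<alpha>) (D e))"
  proof (rule prod.mono_neutral_right[OF finE mE], rule ballI)
    fix e assume "e \<in> E - m ` U"
    then have "D e = UNIV" by (auto simp: D_def)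
    then show "measure_pmf.prob (bernoulli_pmf \<alpha>) (D e) = 1" by simp
  qed
  also have "\<dots> = (\<Prod>u\<in>U. measure_pmf.prob (bernoulli_pmf \<alpha>) (D (m u)))"
    by (simp add: prod.reindex[OF inj])
  also have "\<dots> = (\<Prod>(j, i)\<in>U. if R i j then 1 - \<alpha> else 1)"
  proof (rule prod.cong, simp, clarify)
    fix j i assume u: "(j, i) \<in> U"
    have "D (m (j, i)) = (if R i j then {False} else UNIV)"
      using inj u by (auto simp: D_def inj_on_def)
    then show "measure_pmf.prob (bernoulli_pmf \<alpha>) (D (m (j, i))) = (if R i j then 1 - \<alpha> else 1)"
      using \<alpha> by (simp add: measure_pmf_single)
  qed
  also have "\<dots> = (\<Prod>j\<in>{1..n} - T. \<Prod>i\<in>T. if R i j then 1 - \<alpha> else 1)"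
    unfolding U_def by (simp add: prod.cartesian_product)
  finally show ?thesis by (simp add: E_def)
qed

definition cut_off :: "nat \<Rightarrow> nat set \<Rightarrow> ((nat \<Rightarrow> nat set) \<times> (nat \<times> nat \<Rightarrow> bool)) set" where
  "cut_off n T = {(S, B). \<forall>i\<in>T. \<forall>j\<in>{1..n} - T. S i \<inter> S j \<noteq> {} \<longrightarrow> \<not> B (min i j, max i j)}"

text \<open>Conditionally on the rings of the nodes in \<open>T\<close>, the events that an outside node is adjacent to no member
  of \<open>T\<close> are independent over the \<open>n - card T\<close> outside nodes and equally likely. Singletons \<open>T\<close> give the
  first moment of the number of isolated nodes, two-element sets the second.\<close>

lemma prob_cut_off:
  assumes T: "T \<subseteq> {1..n}" and KP: "K \<le> P" and \<alpha>: "0 \<le> \<alpha>" "\<alpha> \<le> 1"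
  shows "measure_pmf.prob (key_channel_pmf n K P \<alpha>) (cut_off n T) =
     measure_pmf.expectation (Pi_pmf T {} (\<lambda>_. key_ring_pmf K P))
       (\<lambda>S. measure_pmf.expectation (key_ring_pmf K P)
              (\<lambda>s. \<Prod>i\<in>T. if S i \<inter> s \<noteq> {} then 1 - \<alpha> else 1) ^ (n - card T))"
proof -
  let ?R = "key_ring_pmf K P" and ?V = "{1..n}"
  let ?E = "{(i, j). 1 \<le> i \<and> i < j \<and> j \<le> n}"
  let ?B = "Pi_pmf ?E False (\<lambda>_. bernoulli_pmf \<alpha>)"
  let ?g = "\<lambda>A s. if A \<inter> s \<noteq> {} then 1 - \<alpha> else (1::real)"
  have finT: "finite T" using T finite_subset by blast
  have finR: "finite (set_pmf ?R)" using key_rings[OF KP] by (simp add: set_key_ring_pmf[OF KP])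
  have finE: "finite ?E"
    by (rule finite_subset[of _ "{1..n} \<times> {1..n}"]) auto
  have finB: "finite (set_pmf ?B)" by (rule finite_set_Pi_pmf[OF finE]) (rule finite_subset[OF subset_UNIV], simp)
  have finS: "finite (set_pmf (Pi_pmf A {} (\<lambda>_. ?R)))" if "finite A" for A :: "nat set"
    by (intro finite_set_Pi_pmf that finR)
  have "measure_pmf.prob (key_channel_pmf n K P \<alpha>) (cut_off n T)
     = measure_pmf.expectation (key_channel_pmf n K P \<alpha>) (indicator (cut_off n T))"
    by simp
  also have "\<dots> = measure_pmf.expectation (Pi_pmf ?V {} (\<lambda>_. ?R)) (\<lambda>S.
        measure_pmf.expectation ?B (\<lambda>B. indicator (cut_off n T) (S, B)))"
    unfolding key_channel_pmf_def by (rule expectation_pair_pmf[OF finS[OF finite_atLeastAtMost] finB])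
  also have "\<dots> = measure_pmf.expectation (Pi_pmf ?V {} (\<lambda>_. ?R)) (\<lambda>S.
        (\<Prod>j\<in>?V - T. \<Prod>i\<in>T. ?g (S i) (S j)))"
  proof (rule Bochner_Integration.integral_cong[OF refl])
    fix S :: "nat \<Rightarrow> nat set"
    have "(\<lambda>B. indicator (cut_off n T) (S, B) :: real) =
        indicator {B. \<forall>i\<in>T. \<forall>j\<in>?V - T. S i \<inter> S j \<noteq> {} \<longrightarrow> \<not> B (min i j, max i j)}"
      by (auto simp: fun_eq_iff indicator_def cut_off_def)
    then show "measure_pmf.expectation ?B (\<lambda>B. indicator (cut_off n T) (S, B))
       = (\<Prod>j\<in>?V - T. \<Prod>i\<in>T. ?g (S i) (S j))"
      using prob_pairs_absent[OF T \<alpha>, of "\<lambda>i j. S i \<inter> S j \<noteq> {}"] by simp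
  qed
  also have "?V = T \<union> (?V - T)" using T by blast
  also have "measure_pmf.expectation (Pi_pmf (T \<union> (?V - T)) {} (\<lambda>_. ?R)) (\<lambda>S.
        (\<Prod>j\<in>(T \<union> (?V - T)) - T. \<Prod>i\<in>T. ?g (S i) (S j)))
     = measure_pmf.expectation (Pi_pmf T {} (\<lambda>_. ?R)) (\<lambda>S.
         measure_pmf.expectation (Pi_pmf (?V - T) {} (\<lambda>_. ?R)) (\<lambda>S'.
           (\<Prod>j\<in>?V - T. \<Prod>i\<in>T. ?g (S i) (S' j))))"
    using finT
    by (subst Pi_pmf_union) (auto simp: expectation_pair_pmf finS intro!: Bochner_Integration.integral_cong prod.cong)
  also have "\<dots> = measure_pmf.expectation (Pi_pmf T {} (\<lambda>_. ?R)) (\<lambda>S.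
         \<Prod>j\<in>?V - T. measure_pmf.expectation ?R (\<lambda>s. \<Prod>i\<in>T. ?g (S i) s))"
    using \<alpha> by (intro Bochner_Integration.integral_cong[OF refl] expectation_prod_Pi_pmf)
      (auto intro!: integrable_measure_pmf_finite finR prod_nonneg)
  also have "\<dots> = measure_pmf.expectation (Pi_pmf T {} (\<lambda>_. ?R)) (\<lambda>S.
         measure_pmf.expectation ?R (\<lambda>s. \<Prod>i\<in>T. ?g (S i) s) ^ (n - card T))"
    using T finT by (simp add: card_Diff_subset)
  finally show ?thesis .
qed

lemma isolated_node_kg_edges:
  assumes "i \<in> {1..n}"
  shows "isolated_node (kg_edges n S B) i \<longleftrightarrow> (S, B) \<in> cut_off n {i}"
proof -
  have "{i, j} \<in> kg_edges n S B \<longleftrightarrow>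
     j \<in> {1..n} - {i} \<and> S i \<inter> S j \<noteq> {} \<and> B (min i j, max i j)" for j
    unfolding kg_edges_def using assms
    by (cases i j rule: linorder_cases) (auto simp: doubleton_eq_iff min_def max_def)
  then show ?thesis unfolding isolated_node_def cut_off_def by auto
qed

text \<open>Forgetting the channel between the two nodes makes the event amenable to \<open>prob_cut_off\<close>, at the
  price of an inequality.\<close>

lemma cut_off_both_subset:
  assumes "i \<noteq> i'"
  shows "cut_off n {i} \<inter> cut_off n {i'} \<subseteq> cut_off n {i, i'}"
  using assms by (auto simp: cut_off_def)

section \<open>Isolation of one node and of two nodes\<close>

lemma expectation_not_adjacent_to_one:
  assumes "K \<le> P" "A \<subseteq> {1..P}" "card A = K"
  shows "measure_pmf.expectation (key_ring_pmf K P) (\<lambda>s. if A \<inter> s \<noteq> {} then 1 - \<alpha> else 1)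
     = 1 - \<alpha> * (1 - q K P)"
proof -
  have "(\<lambda>s. if A \<inter> s \<noteq> {} then 1 - \<alpha> else 1) =
     (\<lambda>s. (1 - \<alpha>) + \<alpha> * indicator {s. A \<inter> s = {}} s)" by (auto simp: fun_eq_iff)
  then have "measure_pmf.expectation (key_ring_pmf K P) (\<lambda>s. if A \<inter> s \<noteq> {} then 1 - \<alpha> else 1)
     = (1 - \<alpha>) + \<alpha> * measure_pmf.prob (key_ring_pmf K P) {s. A \<inter> s = {}}"
    by (simp add: integrable_measure_pmf_finite set_key_ring_pmf[OF assms(1)] key_rings[OF assms(1)])
  then show ?thesis using assms by (simp add: prob_key_ring_avoids q_eq_choose algebra_simps)
qed

lemma prob_isolated:
  assumes i: "i \<in> {1..n}" and KP: "K \<le> P" and \<alpha>: "0 \<le> \<alpha>" "\<alpha> \<le> 1"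
  shows "measure_pmf.prob (key_channel_pmf n K P \<alpha>) (cut_off n {i}) = (1 - \<alpha> * (1 - q K P)) ^ (n - 1)"
proof -
  have "measure_pmf.prob (key_channel_pmf n K P \<alpha>) (cut_off n {i}) =
     measure_pmf.expectation (key_ring_pmf K P) (\<lambda>A. measure_pmf.expectation (key_ring_pmf K P)
              (\<lambda>s. if A \<inter> s \<noteq> {} then 1 - \<alpha> else 1) ^ (n - 1))"
    using i by (simp add: prob_cut_off[OF _ KP \<alpha>] Pi_pmf_singleton)
  also have "\<dots> = measure_pmf.expectation (key_ring_pmf K P) (\<lambda>A. (1 - \<alpha> * (1 - q K P)) ^ (n - 1))"
    by (intro integral_cong_AE)
      (auto simp: AE_measure_pmf_iff set_key_ring_pmf[OF KP] expectation_not_adjacent_to_one[OF KP])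
  finally show ?thesis by simp
qed

text \<open>The product is \<open>1 - \<alpha>\<close> to the number of rings met. Its expectation is an affine function of the
  probability of avoiding both rings, which is at most \<open>q\<^sup>2\<close> for disjoint rings by
  \<open>binomial_log_concave_shift\<close> and at most \<open>q\<close> in general.\<close>

lemma expectation_not_adjacent_to_two_le:
  assumes KP: "K \<le> P" and A: "A \<subseteq> {1..P}" "card A = K" "A' \<subseteq> {1..P}" "card A' = K"
    and \<alpha>: "0 \<le> \<alpha>" "\<alpha> \<le> 1"
  defines "p \<equiv> \<alpha> * (1 - q K P)"
  shows "measure_pmf.expectation (key_ring_pmf K P)
      (\<lambda>s. (if A \<inter> s \<noteq> {} then 1 - \<alpha> else 1) * (if A' \<inter> s \<noteq> {} then 1 - \<alpha> else 1))
     \<le> (if A \<inter> A' = {} then (1 - p)\<^sup>2 else 1 - 2 * p + \<alpha> * p)"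
proof -
  let ?R = "key_ring_pmf K P"
  define \<kappa> where "\<kappa> = measure_pmf.prob ?R {s. (A \<union> A') \<inter> s = {}}"
  have finR: "finite (set_pmf ?R)" using key_rings[OF KP] by (simp add: set_key_ring_pmf[OF KP])
  note int = integrable_measure_pmf_finite[OF finR]
  have avoid: "measure_pmf.prob ?R {s. A \<inter> s = {}} = q K P"
     "measure_pmf.prob ?R {s. A' \<inter> s = {}} = q K P"
    using KP A by (simp_all add: prob_key_ring_avoids q_eq_choose)
  have "(\<lambda>s. (if A \<inter> s \<noteq> {} then 1 - \<alpha> else 1) * (if A' \<inter> s \<noteq> {} then 1 - \<alpha> else 1)) =
     (\<lambda>s. (1 - \<alpha>)\<^sup>2 + (\<alpha> * (1 - \<alpha>) * indicator {s. A \<inter> s = {}} s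
        + (\<alpha> * (1 - \<alpha>) * indicator {s. A' \<inter> s = {}} s
        + \<alpha>\<^sup>2 * indicator {s. (A \<union> A') \<inter> s = {}} s)))"
    by (auto simp: fun_eq_iff indicator_def power2_eq_square algebra_simps Int_Un_distrib2)
  then have "measure_pmf.expectation ?R
      (\<lambda>s. (if A \<inter> s \<noteq> {} then 1 - \<alpha> else 1) * (if A' \<inter> s \<noteq> {} then 1 - \<alpha> else 1))
    = (1 - \<alpha>)\<^sup>2 + (\<alpha> * (1 - \<alpha>) * q K P + (\<alpha> * (1 - \<alpha>) * q K P + \<alpha>\<^sup>2 * \<kappa>))"
    by (simp add: int avoid \<kappa>_def)
  also have "\<dots> \<le> (if A \<inter> A' = {} then (1 - p)\<^sup>2 else 1 - 2 * p + \<alpha> * p)"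
  proof (cases "A \<inter> A' = {}")
    case True
    have "finite A" "finite A'" using A finite_subset by blast+
    then have "card (A \<union> A') = 2 * K" using True A by (simp add: card_Un_disjoint)
    then have k: "\<kappa> = real ((P - 2 * K) choose K) / real (P choose K)"
      using prob_key_ring_avoids[OF KP, of "A \<union> A'"] A by (simp add: \<kappa>_def)
    have "real (((P - 2 * K) choose K) * (P choose K)) \<le> real (((P - K) choose K)\<^sup>2)"
      by (rule of_nat_mono) (rule binomial_log_concave_shift)
    then have "\<kappa> \<le> (q K P)\<^sup>2"
      using KP zero_less_binomial[OF KP] by (simp add: k q_eq_choose divide_simps power2_eq_square)
    then have "\<alpha>\<^sup>2 * \<kappa> \<le> \<alpha>\<^sup>2 * (q K P)\<^sup>2" by (intro mult_left_mono) auto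
    then show ?thesis using True by (simp add: p_def power2_eq_square algebra_simps)
  next
    case False
    have "\<kappa> \<le> q K P"
      unfolding \<kappa>_def avoid(1)[symmetric] by (intro measure_pmf.finite_measure_mono) auto
    then have "\<alpha>\<^sup>2 * \<kappa> \<le> \<alpha>\<^sup>2 * q K P" by (intro mult_left_mono) auto
    then show ?thesis using False by (simp add: p_def power2_eq_square algebra_simps)
  qed
  finally show ?thesis .
qed

text \<open>Averaging the two cases of \<open>expectation_not_adjacent_to_two_le\<close>: a ring is disjoint from a given one with
  probability \<open>q\<close>.\<close>

lemma prob_both_isolated_le:
  assumes i: "i \<in> {1..n}" "i' \<in> {1..n}" "i \<noteq> i'" and KP: "K \<le> P" and \<alpha>: "0 \<le> \<alpha>" "\<alpha> \<le> 1"
  defines "p \<equiv> \<alpha> * (1 - q K P)"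
  shows "measure_pmf.prob (key_channel_pmf n K P \<alpha>) (cut_off n {i} \<inter> cut_off n {i'})
     \<le> q K P * (1 - p) ^ (2 * (n - 2)) + (1 - q K P) * (1 - 2 * p + \<alpha> * p) ^ (n - 2)"
proof -
  let ?R = "key_ring_pmf K P"
  let ?a = "((1 - p)\<^sup>2) ^ (n - 2)" and ?b = "(1 - 2 * p + \<alpha> * p) ^ (n - 2)"
  let ?h = "\<lambda>A A'. measure_pmf.expectation ?R
      (\<lambda>s. (if A \<inter> s \<noteq> {} then 1 - \<alpha> else 1) * (if A' \<inter> s \<noteq> {} then 1 - \<alpha> else 1))"
  have finR: "finite (set_pmf ?R)" using key_rings[OF KP] by (simp add: set_key_ring_pmf[OF KP])
  note int = integrable_measure_pmf_finite[OF finR]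
  have "measure_pmf.prob (key_channel_pmf n K P \<alpha>) (cut_off n {i} \<inter> cut_off n {i'})
     \<le> measure_pmf.prob (key_channel_pmf n K P \<alpha>) (cut_off n {i, i'})"
    by (intro measure_pmf.finite_measure_mono cut_off_both_subset i) auto
  also have "\<dots> = measure_pmf.expectation ?R (\<lambda>A. measure_pmf.expectation ?R (\<lambda>A'. ?h A A' ^ (n - 2)))"
    using i by (simp add: prob_cut_off[OF _ KP \<alpha>] Pi_pmf_insert Pi_pmf_singleton
        expectation_pair_pmf finR numeral_2_eq_2)
  also have "\<dots> \<le> measure_pmf.expectation ?R (\<lambda>A. q K P * ?a + (1 - q K P) * ?b)"
  proof (rule integral_mono_AE[OF int int])
    show "AE A in ?R. measure_pmf.expectation ?R (\<lambda>A'. ?h A A' ^ (n - 2)) \<le> q K P * ?a + (1 - q K P) * ?b"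
    proof (rule AE_pmfI)
      fix A assume "A \<in> set_pmf ?R"
      then have A: "A \<subseteq> {1..P}" "card A = K" by (auto simp: set_key_ring_pmf[OF KP])
      have "measure_pmf.expectation ?R (\<lambda>A'. ?h A A' ^ (n - 2))
         \<le> measure_pmf.expectation ?R (\<lambda>A'. ?b + (?a - ?b) * indicator {A'. A \<inter> A' = {}} A')"
      proof (rule integral_mono_AE[OF int int], rule AE_pmfI)
        fix A' assume "A' \<in> set_pmf ?R"
        then have A': "A' \<subseteq> {1..P}" "card A' = K" by (auto simp: set_key_ring_pmf[OF KP])
        have "0 \<le> ?h A A'" using \<alpha> by (intro Bochner_Integration.integral_nonneg) auto
        then have "?h A A' ^ (n - 2) \<le> (if A \<inter> A' = {} then (1 - p)\<^sup>2 else 1 - 2 * p + \<alpha> * p) ^ (n - 2)"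
          unfolding p_def by (intro power_mono expectation_not_adjacent_to_two_le KP A A' \<alpha>)
        also have "\<dots> = ?b + (?a - ?b) * indicator {A'. A \<inter> A' = {}} A'" by simp
        finally show "?h A A' ^ (n - 2) \<le> ?b + (?a - ?b) * indicator {A'. A \<inter> A' = {}} A'" .
      qed
      also have "\<dots> = ?b + (?a - ?b) * q K P"
        using A KP by (simp add: int prob_key_ring_avoids q_eq_choose)
      finally show "measure_pmf.expectation ?R (\<lambda>A'. ?h A A' ^ (n - 2)) \<le> q K P * ?a + (1 - q K P) * ?b"
        by (simp add: algebra_simps)
    qed
  qed
  finally show ?thesis by (simp add: power_mult)
qed

lemma prob_no_isolated_eq:
  "prob_no_isolated n K P \<alpha> =
     measure_pmf.prob (key_channel_pmf n K P \<alpha>) (- (\<Union>i\<in>{1..n}. cut_off n {i}))"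
proof -
  have "(\<lambda>(S, B). kg_edges n S B) -` {E. \<forall>i\<in>{1..n}. \<not> isolated_node E i}
     = - (\<Union>i\<in>{1..n}. cut_off n {i})"
    by (auto simp: isolated_node_kg_edges)
  then show ?thesis by (simp add: prob_no_isolated_def kg_graph_pmf_def)
qed

section \<open>The second moment method\<close>

text \<open>Chebyshev's inequality for the number \<open>X\<close> of events that occur: \<open>(X - m)\<^sup>2\<close> equals \<open>m\<^sup>2\<close> where none
  does, and its expectation is the variance of \<open>X\<close>.\<close>

lemma prob_none_le_second_moment:
  fixes M :: "'a pmf" and A :: "'i \<Rightarrow> 'a set"
  assumes "finite I"
  defines "m \<equiv> \<Sum>i\<in>I. measure_pmf.prob M (A i)"
  shows "m\<^sup>2 * measure_pmf.prob M (- (\<Union>i\<in>I. A i))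
     \<le> (\<Sum>i\<in>I. \<Sum>j\<in>I. measure_pmf.prob M (A i \<inter> A j)) - m\<^sup>2"
proof -
  define X :: "'a \<Rightarrow> real" where "X = (\<lambda>x. \<Sum>i\<in>I. indicator (A i) x)"
  have int: "integrable M (indicator B :: 'a \<Rightarrow> real)" for B
    by (rule integrable_real_indicator) (auto simp: measure_pmf.emeasure_eq_measure)
  have EX: "measure_pmf.expectation M X = m"
    by (simp add: X_def m_def int)
  have X2: "(\<lambda>x. (X x)\<^sup>2) = (\<lambda>x. \<Sum>i\<in>I. \<Sum>j\<in>I. indicator (A i \<inter> A j) x)"
    by (simp add: X_def power2_eq_square sum_product indicator_inter_arith)
  have iX: "integrable M X" unfolding X_def by (simp add: int)
  have iX2: "integrable M (\<lambda>x. (X x)\<^sup>2)" unfolding X2 by (simp add: int)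
  have "m\<^sup>2 * measure_pmf.prob M (- (\<Union>i\<in>I. A i))
     = measure_pmf.expectation M (\<lambda>x. m\<^sup>2 * indicator (- (\<Union>i\<in>I. A i)) x)"
    by (simp add: int)
  also have "\<dots> \<le> measure_pmf.expectation M (\<lambda>x. (X x)\<^sup>2 - 2 * m * X x + m\<^sup>2)"
  proof (rule integral_mono)
    fix x
    have "X x = 0" if "x \<in> - (\<Union>i\<in>I. A i)"
      using that by (auto simp: X_def intro!: sum.neutral)
    moreover have "(X x)\<^sup>2 - 2 * m * X x + m\<^sup>2 = (X x - m)\<^sup>2"
      by (simp add: power2_eq_square algebra_simps)
    ultimately show "m\<^sup>2 * indicator (- (\<Union>i\<in>I. A i)) x \<le> (X x)\<^sup>2 - 2 * m * X x + m\<^sup>2"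
      by (cases "x \<in> - (\<Union>i\<in>I. A i)") simp_all
  qed (use int iX iX2 in simp_all)
  also have "\<dots> = measure_pmf.expectation M (\<lambda>x. (X x)\<^sup>2) - m\<^sup>2"
    using iX iX2 by (simp add: EX) (simp add: power2_eq_square)
  also have "measure_pmf.expectation M (\<lambda>x. (X x)\<^sup>2) = (\<Sum>i\<in>I. \<Sum>j\<in>I. measure_pmf.prob M (A i \<inter> A j))"
    unfolding X2 by (simp add: int)
  finally show ?thesis .
qed

text \<open>Convexity in \<open>a\<close>: the left side is at most the chord between \<open>a = 0\<close> and \<open>a = 1\<close>.\<close>

lemma power_one_plus_scaled_le:
  fixes a u :: real
  assumes "0 \<le> a" "a \<le> 1" "0 \<le> u"
  shows "(1 + a * u) ^ m - 1 \<le> a * ((1 + u) ^ m - 1)"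
proof (induction m)
  case (Suc m)
  define M where "M = (1 + u) ^ m - 1"
  have M: "0 \<le> M" using assms by (simp add: M_def)
  have "(1 + a * u) ^ Suc m \<le> (1 + a * u) * (1 + a * M)"
    using Suc assms by (simp add: M_def mult_left_mono)
  also have "\<dots> = 1 + a * (u + M + a * (u * M))" by (simp add: algebra_simps)
  also have "\<dots> \<le> 1 + a * (u + M + 1 * (u * M))"
    using assms M by (intro add_left_mono mult_left_mono mult_right_mono) auto
  also have "\<dots> = 1 + a * ((1 + u) ^ Suc m - 1)" by (simp add: M_def algebra_simps)
  finally show ?case by simp
qed simp

text \<open>Intersecting rings cost a factor \<open>(1 + a u) ^ m\<close> with \<open>u = p / (1 - p)\<^sup>2\<close> over independent nodes. Convexity
  bounds its excess over 1 by \<open>a exp (m u)\<close>; the weight \<open>1 - Q\<close> of the intersecting case then completes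
  \<open>a\<close> to \<open>p\<close>.\<close>

lemma second_moment_ratio:
  fixes Q a p :: real
  assumes "0 \<le> Q" "Q \<le> 1" "0 \<le> a" "a \<le> 1" and p: "p = a * (1 - Q)" "p < 1"
  shows "Q * (1 - p) ^ (2 * m) + (1 - Q) * (1 - 2 * p + a * p) ^ m
     \<le> (1 - p) ^ (2 * m) * (1 + p * exp (real m * (p / (1 - p)\<^sup>2)))"
proof -
  define u where "u = p / (1 - p)\<^sup>2"
  have p0: "0 \<le> p" using assms by simp
  have pos: "0 < (1 - p)\<^sup>2" using p by simp
  have u: "0 \<le> u" using p0 by (simp add: u_def)
  have up: "u * (1 - p)\<^sup>2 = p" using pos by (simp add: u_def)
  have ap: "a * p \<le> p" "a * p \<ge> 0" using p0 assms by (auto intro: mult_left_le_one_le)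
  have "p \<le> a" unfolding p using assms by (simp add: mult_left_le)
  then have "p\<^sup>2 \<le> a * p" using p0 by (simp add: power2_eq_square mult_right_mono)
  then have nn: "0 \<le> 1 - 2 * p + a * p"
    using zero_le_power2[of "1 - p"] by (simp add: power2_diff)
  have "(1 - p)\<^sup>2 * (1 + a * u) = (1 - p)\<^sup>2 + a * (u * (1 - p)\<^sup>2)" by (simp add: algebra_simps)
  also have "\<dots> = 1 - 2 * p + p\<^sup>2 + a * p" unfolding up by (simp add: power2_diff)
  finally have "1 - 2 * p + a * p \<le> (1 - p)\<^sup>2 * (1 + a * u)" by simp
  then have "(1 - 2 * p + a * p) ^ m \<le> ((1 - p)\<^sup>2 * (1 + a * u)) ^ m"
    using nn by (rule power_mono)
  also have "\<dots> = (1 - p) ^ (2 * m) * (1 + a * u) ^ m"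
    by (simp add: power_mult_distrib power_mult)
  also have "\<dots> \<le> (1 - p) ^ (2 * m) * (1 + a * exp (real m * u))"
  proof (rule mult_left_mono)
    have "(1 + u) ^ m \<le> exp u ^ m" using u by (intro power_mono exp_ge_add_one_self) auto
    then have "(1 + u) ^ m - 1 \<le> exp (real m * u)" by (simp add: exp_of_nat_mult)
    then have "a * ((1 + u) ^ m - 1) \<le> a * exp (real m * u)" using assms by (intro mult_left_mono)
    then show "(1 + a * u) ^ m \<le> 1 + a * exp (real m * u)"
      using power_one_plus_scaled_le[of a u m] u assms by linarith
  qed simp
  finally have "(1 - Q) * (1 - 2 * p + a * p) ^ m \<le> (1 - Q) * ((1 - p) ^ (2 * m) * (1 + a * exp (real m * u)))"
    using assms by (intro mult_left_mono) auto
  also have "\<dots> = (1 - p) ^ (2 * m) * ((1 - Q) + p * exp (real m * u))"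
    by (simp add: p(1) algebra_simps)
  finally show ?thesis by (simp add: u_def algebra_simps)
qed

section \<open>Asymptotics at the critical scaling\<close>

lemma critical_sequence:
  fixes p :: "nat \<Rightarrow> real"
  assumes "p \<sim>[sequentially] (\<lambda>n. c * (ln (real n) / real n))" "c > 0"
  shows "(\<lambda>n. p n * real n / ln (real n)) \<longlonglongrightarrow> c" "p \<longlonglongrightarrow> 0"
proof -
  have "(\<lambda>n. p n / (c * (ln (real n) / real n))) \<longlonglongrightarrow> 1"
  proof (rule asymp_equivD_strong[OF assms(1)])
    show "eventually (\<lambda>n. p n \<noteq> 0 \<or> c * (ln (real n) / real n) \<noteq> 0) sequentially"
      using eventually_gt_at_top[of 1] by eventually_elim (use assms(2) in auto)
  qed
  then have "(\<lambda>n. p n / (c * (ln (real n) / real n)) * c) \<longlonglongrightarrow> 1 * c"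
    by (rule tendsto_mult_right)
  moreover have "eventually (\<lambda>n. p n / (c * (ln (real n) / real n)) * c = p n * real n / ln (real n)) sequentially"
    using eventually_gt_at_top[of 1] by eventually_elim (use assms(2) in \<open>simp add: field_simps\<close>)
  ultimately show t: "(\<lambda>n. p n * real n / ln (real n)) \<longlonglongrightarrow> c"
    using Lim_transform_eventually[of _ "1 * c"] by simp
  have "(\<lambda>n. p n * real n / ln (real n) * (ln (real n) / real n)) \<longlonglongrightarrow> c * 0"
    by (intro tendsto_mult t lim_ln_over_n)
  moreover have "eventually (\<lambda>n. p n * real n / ln (real n) * (ln (real n) / real n) = p n) sequentially"
    using eventually_gt_at_top[of 1] by eventually_elim simp
  ultimately show "p \<longlonglongrightarrow> 0"
    using Lim_transform_eventually[of _ "c * 0"] by simp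
qed

text \<open>With any \<open>d\<close> strictly between 1 and \<open>c\<close>, eventually \<open>(n - 1) p n \<ge> d ln n\<close>, and \<open>1 - x \<le> exp (- x)\<close>
  bounds the sequence by \<open>n powr (1 - d)\<close>.\<close>

lemma first_moment_vanishes:
  fixes p :: "nat \<Rightarrow> real"
  assumes p: "p \<sim>[sequentially] (\<lambda>n. c * (ln (real n) / real n))" and c: "c > 1"
    and p1: "eventually (\<lambda>n. p n \<le> 1) sequentially"
  shows "(\<lambda>n. real n * (1 - p n) ^ (n - 1)) \<longlonglongrightarrow> 0"
proof -
  have c0: "c > 0" using c by simp
  note t = critical_sequence[OF p c0]
  obtain d where d: "1 < d" "d < c" using dense[OF c] by blast
  have "(\<lambda>n. p n / ln (real n)) \<longlonglongrightarrow> 0"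
    by (rule real_tendsto_divide_at_top[OF t(2) filterlim_compose[OF ln_at_top filterlim_real_sequentially]])
  with t(1) have "(\<lambda>n. p n * real n / ln (real n) - p n / ln (real n)) \<longlonglongrightarrow> c - 0"
    by (rule tendsto_diff)
  then have "eventually (\<lambda>n. p n * real n / ln (real n) - p n / ln (real n) > d) sequentially"
    by (rule order_tendstoD(1)) (use d in simp)
  then have bound: "eventually (\<lambda>n. real n * (1 - p n) ^ (n - 1) \<le> real n powr (- (d - 1))) sequentially"
    using p1 eventually_gt_at_top[of 1]
  proof eventually_elim
    case (elim n)
    have l: "ln (real n) > 0" using elim(3) by simp
    have "d * ln (real n) < (p n * real n / ln (real n) - p n / ln (real n)) * ln (real n)"
      using elim(1) l by (rule mult_strict_right_mono)
    also have "\<dots> = real (n - 1) * p n" using l elim(3) by (simp add: field_simps of_nat_diff)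
    finally have e: "d * ln (real n) \<le> real (n - 1) * p n" by simp
    have "(1 - p n) ^ (n - 1) \<le> exp (- p n) ^ (n - 1)"
      using exp_ge_add_one_self[of "- p n"] elim(2) by (intro power_mono) auto
    also have "\<dots> = exp (- (real (n - 1) * p n))" by (simp flip: exp_of_nat_mult)
    also have "\<dots> \<le> exp (- (d * ln (real n)))" using e by simp
    finally have "real n * (1 - p n) ^ (n - 1) \<le> real n * real n powr (- d)"
      using elim(3) by (intro mult_left_mono) (simp_all add: powr_def)
    also have "\<dots> = real n powr (- (d - 1))"
      using elim(3) powr_add[of "real n" 1 "- d"] by simp
    finally show ?case .
  qed
  have lim: "(\<lambda>n. real n powr (- (d - 1))) \<longlonglongrightarrow> 0"
    by (rule tendsto_neg_powr[OF _ filterlim_real_sequentially]) (use d in simp)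
  have "eventually (\<lambda>n. 0 \<le> real n * (1 - p n) ^ (n - 1)) sequentially"
    using p1 by eventually_elim simp
  from this bound tendsto_const lim show ?thesis by (rule tendsto_sandwich)
qed

text \<open>With any \<open>d\<close> strictly between \<open>c\<close> and 1, eventually \<open>n p n / (1 - p n)\<^sup>2 \<le> d ln n\<close>. This one inequality
  makes both the reciprocal of the first moment and the correlation term \<open>p n exp (...)\<close> of order
  \<open>n powr (d - 1)\<close>, up to a logarithm.\<close>

lemma second_moment_bound_vanishes:
  fixes p :: "nat \<Rightarrow> real"
  assumes p: "p \<sim>[sequentially] (\<lambda>n. c * (ln (real n) / real n))" and c: "0 < c" "c < 1"
    and p0: "eventually (\<lambda>n. 0 \<le> p n) sequentially"
  shows "(\<lambda>n. 1 / (real n * (1 - p n) ^ (n - 1))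
            + ((1 + p n * exp (real n * (p n / (1 - p n)\<^sup>2))) / (1 - p n)\<^sup>2 - 1)) \<longlonglongrightarrow> 0"
proof -
  note t = critical_sequence[OF p c(1)]
  obtain d where d: "c < d" "d < 1" using dense[OF c(2)] by blast
  have "(\<lambda>n. (p n * real n / ln (real n)) / (1 - p n)\<^sup>2) \<longlonglongrightarrow> c / (1 - 0)\<^sup>2"
    by (intro tendsto_divide tendsto_power tendsto_diff tendsto_const t) simp
  then have "eventually (\<lambda>n. (p n * real n / ln (real n)) / (1 - p n)\<^sup>2 < d) sequentially"
    by (rule order_tendstoD(2)) (use d in simp)
  then have e: "eventually (\<lambda>n. real n * (p n / (1 - p n)\<^sup>2) \<le> d * ln (real n)) sequentially"
    using eventually_gt_at_top[of 1]
  proof eventually_elim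
    case (elim n)
    have l: "ln (real n) > 0" using elim(2) by simp
    have "(p n * real n / ln (real n)) / (1 - p n)\<^sup>2 * ln (real n) \<le> d * ln (real n)"
      using elim(1) l by (intro mult_right_mono) auto
    then show ?case using l by (simp add: field_simps)
  qed
  have small: "eventually (\<lambda>n. p n < 1) sequentially"
    using t(2) by (rule order_tendstoD(2)) simp
  have up: "eventually (\<lambda>n. 1 / (real n * (1 - p n) ^ (n - 1)) \<le> real n powr (- (1 - d))) sequentially"
    using e small p0 eventually_gt_at_top[of 1]
  proof eventually_elim
    case (elim n)
    have pn: "0 \<le> p n" "p n < 1" using elim(2,3) by auto
    have "inverse (1 - p n) = 1 + p n / (1 - p n)" using pn by (simp add: field_simps)
    also have "\<dots> \<le> exp (p n / (1 - p n))" by (rule exp_ge_add_one_self)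
    also have "\<dots> \<le> exp (p n / (1 - p n)\<^sup>2)"
    proof -
      have "(1 - p n)\<^sup>2 \<le> 1 - p n" using pn by (simp add: power2_eq_square mult_left_le)
      then have "p n / (1 - p n) \<le> p n / (1 - p n)\<^sup>2" using pn by (intro divide_left_mono) auto
      then show ?thesis by simp
    qed
    finally have "inverse (1 - p n) ^ (n - 1) \<le> exp (p n / (1 - p n)\<^sup>2) ^ (n - 1)"
      using pn by (intro power_mono) auto
    also have "\<dots> \<le> exp (p n / (1 - p n)\<^sup>2) ^ n" using pn by (intro power_increasing) auto
    also have "\<dots> \<le> exp (d * ln (real n))" using elim(1) by (simp flip: exp_of_nat_mult)
    also have "\<dots> = real n powr d" using elim(4) by (simp add: powr_def)
    finally have "inverse (1 - p n) ^ (n - 1) / real n \<le> real n powr d / real n"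
      by (intro divide_right_mono) auto
    also have "\<dots> = real n powr (- (1 - d))"
      using elim(4) powr_diff[of "real n" d 1] by simp
    finally show ?case by (simp add: field_simps power_inverse)
  qed
  have lo: "eventually (\<lambda>n. 0 \<le> 1 / (real n * (1 - p n) ^ (n - 1))) sequentially"
    using small by eventually_elim simp
  have lim: "(\<lambda>n. real n powr (- (1 - d))) \<longlonglongrightarrow> 0"
    by (rule tendsto_neg_powr[OF _ filterlim_real_sequentially]) (use d in simp)
  from lo up tendsto_const lim
  have one: "(\<lambda>n. 1 / (real n * (1 - p n) ^ (n - 1))) \<longlonglongrightarrow> 0" by (rule tendsto_sandwich)
  have up2: "eventually (\<lambda>n. p n * exp (real n * (p n / (1 - p n)\<^sup>2))
      \<le> (p n * real n / ln (real n)) * (ln (real n) / real n powr (1 - d))) sequentially"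
    using e p0 eventually_gt_at_top[of 1]
  proof eventually_elim
    case (elim n)
    have l: "ln (real n) > 0" using elim(3) by simp
    have "p n * exp (real n * (p n / (1 - p n)\<^sup>2)) \<le> p n * exp (d * ln (real n))"
      using elim(1,2) by (intro mult_left_mono) auto
    also have "\<dots> = p n * (real n / real n powr (1 - d))"
      using elim(3) powr_diff[of "real n" 1 "1 - d"] by (simp add: powr_def)
    also have "\<dots> = (p n * real n / ln (real n)) * (ln (real n) / real n powr (1 - d))"
      using l by simp
    finally show ?case .
  qed
  have lo2: "eventually (\<lambda>n. 0 \<le> p n * exp (real n * (p n / (1 - p n)\<^sup>2))) sequentially"
    using p0 by eventually_elim simp
  have lim2: "(\<lambda>n. (p n * real n / ln (real n)) * (ln (real n) / real n powr (1 - d))) \<longlonglongrightarrow> 0"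
    using tendsto_mult[OF t(1) lim_ln_over_power[of "1 - d"]] d by simp
  from lo2 up2 tendsto_const lim2
  have two: "(\<lambda>n. p n * exp (real n * (p n / (1 - p n)\<^sup>2))) \<longlonglongrightarrow> 0" by (rule tendsto_sandwich)
  have "(\<lambda>n. 1 / (real n * (1 - p n) ^ (n - 1))
            + ((1 + p n * exp (real n * (p n / (1 - p n)\<^sup>2))) / (1 - p n)\<^sup>2 - 1))
     \<longlonglongrightarrow> 0 + ((1 + 0) / (1 - 0)\<^sup>2 - 1)"
    by (intro tendsto_add tendsto_diff tendsto_divide tendsto_power one two t(2) tendsto_const) simp
  then show ?thesis by simp
qed

section \<open>The zero-one law for isolated nodes\<close>

lemma prob_no_isolated_ge:
  assumes KP: "K \<le> P" and \<alpha>: "0 \<le> \<alpha>" "\<alpha> \<le> 1"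
  shows "1 - real n * (1 - \<alpha> * (1 - q K P)) ^ (n - 1) \<le> prob_no_isolated n K P \<alpha>"
proof -
  let ?M = "key_channel_pmf n K P \<alpha>"
  have "measure_pmf.prob ?M (\<Union>i\<in>{1..n}. cut_off n {i}) \<le> (\<Sum>i\<in>{1..n}. measure_pmf.prob ?M (cut_off n {i}))"
    by (rule measure_pmf.finite_measure_subadditive_finite) auto
  also have "\<dots> = real n * (1 - \<alpha> * (1 - q K P)) ^ (n - 1)"
    using prob_isolated[OF _ KP \<alpha>] by simp
  finally show ?thesis
    using measure_pmf.prob_compl[of "\<Union>i\<in>{1..n}. cut_off n {i}" ?M]
    by (simp add: prob_no_isolated_eq Compl_eq_Diff_UNIV)
qed

lemma prob_no_isolated_le:
  assumes n: "2 \<le> n" and KP: "K \<le> P" and \<alpha>: "0 \<le> \<alpha>" "\<alpha> \<le> 1"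
    and p: "p = \<alpha> * (1 - q K P)" "p < 1"
  shows "prob_no_isolated n K P \<alpha> \<le> 1 / (real n * (1 - p) ^ (n - 1))
            + ((1 + p * exp (real n * (p / (1 - p)\<^sup>2))) / (1 - p)\<^sup>2 - 1)"
proof -
  let ?M = "key_channel_pmf n K P \<alpha>" and ?I = "{1..n}"
  define \<mu> where "\<mu> = (1 - p) ^ (n - 1)"
  define w where "w = (1 + p * exp (real n * (p / (1 - p)\<^sup>2))) / (1 - p)\<^sup>2"
  have p0: "0 \<le> p" using q_le_1[OF KP] \<alpha> by (simp add: p(1))
  have p1: "0 < (1 - p)\<^sup>2" using p(2) by simp
  have \<mu>: "0 < \<mu>" using p(2) by (simp add: \<mu>_def)
  have w: "0 \<le> w" using p0 by (simp add: w_def)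
  have single: "measure_pmf.prob ?M (cut_off n {i}) = \<mu>" if "i \<in> ?I" for i
    using prob_isolated[OF that KP \<alpha>] by (simp add: \<mu>_def p(1))
  have exps: "(1 - p) ^ (2 * (n - 2)) * (1 - p)\<^sup>2 = \<mu>\<^sup>2"
  proof -
    have "2 * (n - 2) + 2 = (n - 1) * 2" using n by simp
    then show ?thesis by (metis \<mu>_def power_add power_mult)
  qed
  have pair: "measure_pmf.prob ?M (cut_off n {i} \<inter> cut_off n {j}) \<le> \<mu>\<^sup>2 * w"
    if "i \<in> ?I" "j \<in> ?I" "i \<noteq> j" for i j
  proof -
    have "measure_pmf.prob ?M (cut_off n {i} \<inter> cut_off n {j})
       \<le> q K P * (1 - p) ^ (2 * (n - 2)) + (1 - q K P) * (1 - 2 * p + \<alpha> * p) ^ (n - 2)"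
      using prob_both_isolated_le[OF that KP \<alpha>] by (simp add: p(1))
    also have "\<dots> \<le> (1 - p) ^ (2 * (n - 2)) * (1 + p * exp (real (n - 2) * (p / (1 - p)\<^sup>2)))"
      using q_nonneg q_le_1[OF KP] \<alpha> p by (rule second_moment_ratio)
    also have "\<dots> \<le> (1 - p) ^ (2 * (n - 2)) * (1 + p * exp (real n * (p / (1 - p)\<^sup>2)))"
    proof -
      have "real (n - 2) * (p / (1 - p)\<^sup>2) \<le> real n * (p / (1 - p)\<^sup>2)"
        using p0 p1 by (intro mult_right_mono) auto
      then show ?thesis using p0 p(2) by (intro mult_left_mono add_left_mono) simp_all
    qed
    also have "\<dots> = \<mu>\<^sup>2 * w"
      using p1 unfolding exps[symmetric] w_def by simp
    finally show ?thesis .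
  qed
  have "(real n * \<mu>)\<^sup>2 * prob_no_isolated n K P \<alpha>
     \<le> (\<Sum>i\<in>?I. \<Sum>j\<in>?I. measure_pmf.prob ?M (cut_off n {i} \<inter> cut_off n {j})) - (real n * \<mu>)\<^sup>2"
    using prob_none_le_second_moment[of ?I ?M "\<lambda>i. cut_off n {i}"] single
    by (simp add: prob_no_isolated_eq)
  also have "(\<Sum>i\<in>?I. \<Sum>j\<in>?I. measure_pmf.prob ?M (cut_off n {i} \<inter> cut_off n {j}))
     \<le> (\<Sum>i\<in>?I. \<Sum>j\<in>?I. (if i = j then \<mu> else 0) + \<mu>\<^sup>2 * w)"
  proof (intro sum_mono)
    fix i j assume "i \<in> ?I" "j \<in> ?I"
    then show "measure_pmf.prob ?M (cut_off n {i} \<inter> cut_off n {j}) \<le> (if i = j then \<mu> else 0) + \<mu>\<^sup>2 * w"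
      using single pair w by (cases "i = j") simp_all
  qed
  also have "\<dots> = real n * \<mu> + (real n * \<mu>)\<^sup>2 * w"
    by (simp add: sum.distrib power2_eq_square algebra_simps)
  finally have "(real n * \<mu>)\<^sup>2 * prob_no_isolated n K P \<alpha>
     \<le> real n * \<mu> + (real n * \<mu>)\<^sup>2 * w - (real n * \<mu>)\<^sup>2" by simp
  also have "\<dots> = (real n * \<mu>)\<^sup>2 * (1 / (real n * \<mu>) + (w - 1))"
    using \<mu> n by (simp add: power2_eq_square field_simps)
  finally have "prob_no_isolated n K P \<alpha> \<le> 1 / (real n * \<mu>) + (w - 1)"
    using \<mu> n by (simp add: mult_le_cancel_left_pos)
  then show ?thesis by (simp add: \<mu>_def w_def)
qed

theorem mainTheorem3:
  fixes K P :: "nat \<Rightarrow> nat" and \<alpha> :: "nat \<Rightarrow> real" and c :: real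
  assumes "\<And>n. n \<ge> 1 \<Longrightarrow> 0 < K n \<and> K n < P n"
    and "\<And>n. n \<ge> 1 \<Longrightarrow> 0 \<le> \<alpha> n \<and> \<alpha> n \<le> 1"
    and "c > 0"
    and "(\<lambda>n. \<alpha> n * (1 - q (K n) (P n))) \<sim>[sequentially] (\<lambda>n. c * (ln (real n) / real n))"
  shows "(c < 1 \<longrightarrow> (\<lambda>n. prob_no_isolated n (K n) (P n) (\<alpha> n)) \<longlonglongrightarrow> 0) \<and>
         (c > 1 \<longrightarrow> (\<lambda>n. prob_no_isolated n (K n) (P n) (\<alpha> n)) \<longlonglongrightarrow> 1)"
proof -
  define p where "p = (\<lambda>n. \<alpha> n * (1 - q (K n) (P n)))"
  have asym: "p \<sim>[sequentially] (\<lambda>n. c * (ln (real n) / real n))"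
    using assms(4) by (simp add: p_def)
  have KP: "K n \<le> P n" and \<alpha>: "0 \<le> \<alpha> n" "\<alpha> n \<le> 1" if "n \<ge> 1" for n
    using assms(1,2)[OF that] by simp_all
  have p: "0 \<le> p n" "p n \<le> 1" if "n \<ge> 1" for n
    using KP[OF that] \<alpha>[OF that] q_le_1 q_nonneg by (simp_all add: p_def mult_le_one)
  have p_ev: "eventually (\<lambda>n. 0 \<le> p n) sequentially" "eventually (\<lambda>n. p n \<le> 1) sequentially"
    using p by (auto intro: eventually_sequentiallyI)
  have "(\<lambda>n. prob_no_isolated n (K n) (P n) (\<alpha> n)) \<longlonglongrightarrow> 0" if c: "c < 1"
  proof -
    have "eventually (\<lambda>n. p n < 1) sequentially"
      using critical_sequence(2)[OF asym assms(3)] by (rule order_tendstoD(2)) simp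
    then have up: "eventually (\<lambda>n. prob_no_isolated n (K n) (P n) (\<alpha> n)
       \<le> 1 / (real n * (1 - p n) ^ (n - 1))
            + ((1 + p n * exp (real n * (p n / (1 - p n)\<^sup>2))) / (1 - p n)\<^sup>2 - 1)) sequentially"
      using eventually_ge_at_top[of 2]
    proof eventually_elim
      case (elim n)
      then have n: "n \<ge> 1" by simp
      show ?case by (rule prob_no_isolated_le[OF elim(2) KP[OF n] \<alpha>[OF n] _ elim(1)]) (simp add: p_def)
    qed
    have lo: "eventually (\<lambda>n. 0 \<le> prob_no_isolated n (K n) (P n) (\<alpha> n)) sequentially"
      by (simp add: prob_no_isolated_def)
    from lo up tendsto_const second_moment_bound_vanishes[OF asym assms(3) c p_ev(1)]
    show ?thesis by (rule tendsto_sandwich)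
  qed
  moreover have "(\<lambda>n. prob_no_isolated n (K n) (P n) (\<alpha> n)) \<longlonglongrightarrow> 1" if c: "c > 1"
  proof -
    have lo: "eventually (\<lambda>n. 1 - real n * (1 - p n) ^ (n - 1) \<le> prob_no_isolated n (K n) (P n) (\<alpha> n)) sequentially"
      unfolding p_def by (rule eventually_sequentiallyI[of 1]) (rule prob_no_isolated_ge[OF KP \<alpha>])
    have up: "eventually (\<lambda>n. prob_no_isolated n (K n) (P n) (\<alpha> n) \<le> 1) sequentially"
      by (simp add: prob_no_isolated_def)
    have "(\<lambda>n. 1 - real n * (1 - p n) ^ (n - 1)) \<longlonglongrightarrow> 1"
      using tendsto_diff[OF tendsto_const first_moment_vanishes[OF asym c p_ev(2)], of 1] by simp
    from lo up this tendsto_const show ?thesis by (rule tendsto_sandwich)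
  qed
  ultimately show ?thesis by blast
qed

end
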